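(* For any positive integers $r$ and $t$ with $r\not\equiv 0\pmod 3$, the congruence lattices $$\mathcal L=\mathcal L(r^2t;\,1,\,1+rt,\,1+3rt)\quad\text{and}\quad \mathcal L'=\mathcal L(r^2t;\,1,\,1-rt,\,1-3rt)$$ in $\mathbb Z^3$ are $\|\cdot\|_1^*$-isospectral.
   Context: For $q\in\mathbb N$ and $s_1,s_2,s_3\in\mathbb Z$ coprime to $q$, $\mathcal L(q;s_1,s_2,s_3)=\{(a,b,c)\in\mathbb Z^3: as_1+bs_2+cs_3\equiv 0\pmod q\}$. For $\mu=(a_1,a_2,a_3)\in\mathbb Z^3$, $\|\mu\|_1=\sum_j|a_j|$ and $Z(\mu)=\#\{j:a_j=0\}$; $N_{\mathcal L}(k,\ell)=\#\{\mu\in\mathcal L:\|\mu\|_1=k,\ Z(\mu)=\ell\}$. Two sublattices $\mathcal L,\mathcal L'$ of $\mathbb Z^3$ are $\|\cdot\|_1^*$-isospectral if $N_{\mathcal L}(k,\ell)=N_{\mathcal L'}(k,\ell)$ for every $k\in\mathbb N$ and every $0\le\ell\le 3$. *)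

theory Defs
  imports "HOL-Analysis.Analysis" "HOL-Number_Theory.Cong"
begin

text \<open>The parameters \<open>s1\<close>, \<open>s2\<close>, \<open>s3\<close> are meant to be coprime to \<open>q\<close>; the
  definition itself does not need this.\<close>

definition congruence_lattice :: "nat \<Rightarrow> int \<Rightarrow> int \<Rightarrow> int \<Rightarrow> (int ^ 3) set" where
  "congruence_lattice q s1 s2 s3 =
     {\<mu>. [\<mu> $ 1 * s1 + \<mu> $ 2 * s2 + \<mu> $ 3 * s3 = 0] (mod int q)}"

definition one_norm :: "int ^ 3 \<Rightarrow> int" where
  "one_norm \<mu> = (\<Sum>j\<in>UNIV. \<bar>\<mu> $ j\<bar>)"

definition num_zeros :: "int ^ 3 \<Rightarrow> nat" where
  "num_zeros \<mu> = card {j. \<mu> $ j = 0}"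

definition lattice_count :: "(int ^ 3) set \<Rightarrow> nat \<Rightarrow> nat \<Rightarrow> nat" where
  "lattice_count L k l = card {\<mu> \<in> L. one_norm \<mu> = int k \<and> num_zeros \<mu> = l}"

definition one_norm_star_isospectral :: "(int ^ 3) set \<Rightarrow> (int ^ 3) set \<Rightarrow> bool" where
  "one_norm_star_isospectral L L' \<longleftrightarrow>
     (\<forall>k. \<forall>l\<le>3. lattice_count L k l = lattice_count L' k l)"

text \<open>The sets counted by \<^const>\<open>lattice_count\<close> are finite, so \<^const>\<open>card\<close> is their actual
  number of elements.\<close>

lemma finite_lattice_count_set:
  "finite {\<mu> \<in> L. one_norm \<mu> = int k \<and> num_zeros \<mu> = l}"
proof -
  let ?B = "{- int k..int k}"
  have bound: "\<mu> $ j \<in> ?B" if "one_norm \<mu> = int k" for \<mu> j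
  proof -
    have "\<bar>\<mu> $ j\<bar> \<le> one_norm \<mu>"
      unfolding one_norm_def by (rule member_le_sum) auto
    then show ?thesis using that by auto
  qed
  have "finite {\<mu> :: int ^ 3. \<forall>j. \<mu> $ j \<in> ?B}"
  proof (rule finite_subset)
    show "{\<mu> :: int ^ 3. \<forall>j. \<mu> $ j \<in> ?B} \<subseteq> vec_lambda ` (UNIV \<rightarrow>\<^sub>E ?B)"
    proof
      fix \<mu> :: "int ^ 3"
      assume "\<mu> \<in> {\<mu>. \<forall>j. \<mu> $ j \<in> ?B}"
      then have "vec_nth \<mu> \<in> UNIV \<rightarrow>\<^sub>E ?B" by auto
      then have "vec_lambda (vec_nth \<mu>) \<in> vec_lambda ` (UNIV \<rightarrow>\<^sub>E ?B)" by (rule imageI)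
      then show "\<mu> \<in> vec_lambda ` (UNIV \<rightarrow>\<^sub>E ?B)" by simp
    qed
    show "finite (vec_lambda ` ((UNIV :: 3 set) \<rightarrow>\<^sub>E ?B))"
      by (intro finite_imageI finite_PiE) auto
  qed
  then show ?thesis
    by (rule rev_finite_subset) (use bound in blast)
qed

lemma congruence_lattice_subgroup:
  "0 \<in> congruence_lattice q s1 s2 s3"
  "\<lbrakk>\<mu> \<in> congruence_lattice q s1 s2 s3; \<nu> \<in> congruence_lattice q s1 s2 s3\<rbrakk>
     \<Longrightarrow> \<mu> - \<nu> \<in> congruence_lattice q s1 s2 s3"
proof -
  show "0 \<in> congruence_lattice q s1 s2 s3"
    by (simp add: congruence_lattice_def)
  assume "\<mu> \<in> congruence_lattice q s1 s2 s3" "\<nu> \<in> congruence_lattice q s1 s2 s3"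
  then have "[(\<mu> $ 1 * s1 + \<mu> $ 2 * s2 + \<mu> $ 3 * s3) - (\<nu> $ 1 * s1 + \<nu> $ 2 * s2 + \<nu> $ 3 * s3)
      = 0 - 0] (mod int q)"
    unfolding congruence_lattice_def by (intro cong_diff) auto
  then show "\<mu> - \<nu> \<in> congruence_lattice q s1 s2 s3"
    by (simp add: congruence_lattice_def algebra_simps)
qed

text \<open>All parameters of the form \<open>1 + m r t\<close> are automatically coprime to \<open>r\<^sup>2 t\<close>.\<close>

lemma coprime_one_plus_multiple:
  fixes r t :: nat and m :: int
  shows "coprime (1 + m * int r * int t) (int (r ^ 2 * t))"
proof -
  have *: "coprime (1 + m * int r * int t) x" if "x dvd m * int r * int t" for x
  proof (rule coprimeI)
    fix d assume d: "d dvd 1 + m * int r * int t" "d dvd x"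
    then have "d dvd m * int r * int t"
      using that by (blast intro: dvd_trans)
    with d(1) show "is_unit d"
      using dvd_add_left_iff by blast
  qed
  have "coprime (1 + m * int r * int t) (int r)" "coprime (1 + m * int r * int t) (int t)"
    by (rule *; simp)+
  then show ?thesis
    by (simp add: power2_eq_square)
qed

end

theory Submission
  imports Defs
begin

text \<open>Put \<open>d = r t\<close>, so that the modulus is \<open>r d\<close>. Membership of \<open>(a, b, c)\<close> in the first lattice
  says that \<open>a + b + c = d h\<close> for some \<open>h\<close> with \<open>h + b + 3 c \<equiv> 0 (mod r)\<close>; for the second lattice the
  sign of \<open>h\<close> is reversed. On vectors with exactly one zero, exchanging the two nonzero
  coordinates maps one lattice onto the other, and vectors with at least two zeros lie in both
  lattices or in neither. Vectors without zeros are counted octant by octant. In a mixed octant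
  \<open>(a, b, -c)\<close> put \<open>n = a + b\<close>; the number of \<open>(a, b)\<close> for \<open>h\<close> minus that for \<open>-h\<close> depends on \<open>n\<close> only
  modulo \<open>r\<close>, and \<open>n \<equiv> c\<close>, so these differences cancel under exchanging the values of \<open>n\<close> and \<open>c\<close>, which
  negates \<open>h\<close>. In the positive octant, counting \<open>b\<close> for fixed \<open>c\<close> expresses the count through sums of
  \<open>(h + 2 c) mod r\<close> and \<open>(h + 3 c) mod r\<close> over full periods; a shift of \<open>c\<close> turns \<open>h\<close> into \<open>-h\<close>, since
  \<open>2\<close> and \<open>3\<close> both divide \<open>2 h\<close> modulo \<open>r\<close>.\<close>

section \<open>Sums over a full period, divisibility and residues\<close>

lemma sum_int_period_shift:
  fixes f :: "int \<Rightarrow> int"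
  assumes per: "\<And>x. f (x + p) = f x" and p: "p \<ge> 0"
  shows "(\<Sum>x\<in>{m..<m+p}. f (x + y)) = (\<Sum>x\<in>{m..<m+p}. f x)"
proof -
  \<comment> \<open>Moving the window by one trades \<open>f a\<close> for the equal value
    \<open>f (a + p)\<close>.\<close>
  have step: "(\<Sum>x\<in>{a+1..<a+1+p}. f x) = (\<Sum>x\<in>{a..<a+p}. f x)" for a
  proof (cases "p = 0")
    case False
    with p have p1: "p \<ge> 1" by simp
    have "{a+1..<a+1+p} = insert (a+p) {a+1..<a+p}" "{a..<a+p} = insert a {a+1..<a+p}"
      using p1 by auto
    then show ?thesis by (simp add: per)
  qed simp
  have const: "(\<Sum>x\<in>{a..<a+p}. f x) = (\<Sum>x\<in>{m..<m+p}. f x)" for a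
  proof (induction a rule: int_induct[where k = m])
    case (step1 i) then show ?case using step[of i] by simp
  next
    case (step2 i) then show ?case using step[of "i - 1"] by simp
  qed simp
  have "(\<Sum>x\<in>{m..<m+p}. f (x + y)) = (\<Sum>x\<in>{m+y..<m+y+p}. f x)"
    by (rule sum.reindex_bij_witness[of _ "\<lambda>x. x - y" "\<lambda>x. x + y"]) auto
  also have "\<dots> = (\<Sum>x\<in>{m..<m+p}. f x)" by (rule const)
  finally show ?thesis .
qed

lemma dvd_iff_of_dvd_diff:
  fixes r x y :: int
  assumes "r dvd x - y"
  shows "r dvd x \<longleftrightarrow> r dvd y"
  using dvd_add_right_iff[OF assms, of y] by simp

lemma mod_eq_of_dvd_diff:
  fixes r x y :: int
  assumes "r dvd x - y"
  shows "x mod r = y mod r"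
  using assms by (simp add: mod_eq_dvd_iff)

text \<open>Divisibility by \<open>r * d\<close> forces \<open>d dvd x\<close>, after which
  \<open>d\<close> cancels. This splits the lattice condition into one modulo \<open>d\<close> and
  one modulo \<open>r\<close> on the quotient.\<close>

lemma mult_dvd_add_mult_iff:
  fixes r d x y :: int
  assumes "d \<noteq> 0"
  shows "r * d dvd x + d * y \<longleftrightarrow> d dvd x \<and> r dvd x div d + y"
proof (cases "d dvd x")
  case True
  then obtain h where "x = d * h" by blast
  then show ?thesis
    using assms by (simp add: mult.commute[of r] flip: distrib_left)
next
  case False
  then show ?thesis
    by (metis dvd_add_left_iff dvd_mult_right dvd_triv_left)
qed

text \<open>The sum telescopes: from one integer to the next the residue modulo \<open>r\<close>
  rises by 1, except that it falls by \<open>r - 1\<close> on reaching a multiple of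
  \<open>r\<close>.\<close>

lemma sum_of_bool_dvd_eq:
  fixes x r n :: int
  assumes "r > 0" "n \<ge> 1"
  shows "r * (\<Sum>b\<in>{1..<n}. of_bool (r dvd x + b)) = n - 1 - (x + n - 1) mod r + x mod r"
  using \<open>n \<ge> 1\<close>
proof (induction n rule: int_ge_induct)
  case (step n)
  have "{1..<n+1} = insert n {1..<n}" using step by auto
  moreover have "r * of_bool (r dvd x + n) = 1 - (x + n) mod r + (x + n - 1) mod r"
  proof (cases "r dvd x + n")
    case True
    then obtain j where "x + n = r * j" by blast
    then have "x + n - 1 = (r - 1) + r * (j - 1)" by (simp add: algebra_simps)
    then have "r dvd (x + n - 1) - (r - 1)" by simp
    from mod_eq_of_dvd_diff[OF this] have "(x + n - 1) mod r = r - 1"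
      using \<open>r > 0\<close> by (simp add: zmod_minus1)
    then show ?thesis using True by simp
  next
    case False
    define z where "z = (x + n) mod r"
    have "z \<noteq> 0" "z \<ge> 0" "z < r"
      using False \<open>r > 0\<close> by (auto simp: z_def dvd_eq_mod_eq_0)
    then have z: "z \<ge> 1" "z < r" by auto
    have "r dvd (x + n - 1) - (z - 1)"
      unfolding z_def by (simp add: algebra_simps minus_mod_eq_mult_div)
    from mod_eq_of_dvd_diff[OF this] have "(x + n - 1) mod r = z - 1"
      using z by simp
    then show ?thesis using False by (simp add: z_def)
  qed
  ultimately show ?case using step.IH by (simp add: algebra_simps del: sum_of_bool_eq)
qed simp

section \<open>Positive triples, with the signs of an octant carried by the coefficients\<close>

definition positive_count :: "int \<Rightarrow> int \<Rightarrow> int \<Rightarrow> int \<Rightarrow> int \<Rightarrow> nat" where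
  "positive_count q s1 s2 s3 k =
     card {(a, b, c). a > 0 \<and> b > 0 \<and> c > 0 \<and> a + b + c = k \<and> q dvd s1 * a + s2 * b + s3 * c}"

lemma positive_count_swap12: "positive_count q s2 s1 s3 k = positive_count q s1 s2 s3 k"
  unfolding positive_count_def
  by (rule bij_betw_same_card[OF bij_betw_byWitness[where f = "\<lambda>(a,b,c). (b,a,c)"
        and f' = "\<lambda>(a,b,c). (b,a,c)"]]) (auto simp: algebra_simps)

lemma positive_count_swap23: "positive_count q s1 s3 s2 k = positive_count q s1 s2 s3 k"
  unfolding positive_count_def
  by (rule bij_betw_same_card[OF bij_betw_byWitness[where f = "\<lambda>(a,b,c). (a,c,b)"
        and f' = "\<lambda>(a,b,c). (a,c,b)"]]) (auto simp: algebra_simps)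

lemma positive_count_minus: "positive_count q (- s1) (- s2) (- s3) k = positive_count q s1 s2 s3 k"
proof -
  have "- s1 * a + - s2 * b + - s3 * c = - (s1 * a + s2 * b + s3 * c)" for a b c by simp
  then show ?thesis unfolding positive_count_def by (simp only: dvd_minus_iff)
qed

text \<open>Eliminating \<open>a = k - c - b\<close> turns \<open>a > 0\<close> into the bound
  \<open>b < k - c\<close>.\<close>

lemma positive_count_eq_sum:
  "int (positive_count q s1 s2 s3 k) =
     (\<Sum>c\<in>{1..<k}. \<Sum>b\<in>{1..<k-c}. of_bool (q dvd s1 * (k - c - b) + s2 * b + s3 * c))"
proof -
  define S where "S = (SIGMA c:{1..<k}. {1..<k-c})"
  define T where "T = {(c,b)\<in>S. q dvd s1 * (k - c - b) + s2 * b + s3 * c}"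
  have fin: "finite S" by (simp add: S_def)
  have "positive_count q s1 s2 s3 k = card T"
    unfolding positive_count_def T_def S_def
    by (rule bij_betw_same_card[OF bij_betw_byWitness[where f = "\<lambda>(a,b,c). (c,b)"
          and f' = "\<lambda>(c,b). (k-c-b,b,c)"]]) (auto simp: algebra_simps)
  also have "int (card T) = (\<Sum>(c,b)\<in>S. of_bool (q dvd s1 * (k - c - b) + s2 * b + s3 * c))"
  proof -
    have "T = S \<inter> {x. case x of (c,b) \<Rightarrow> q dvd s1 * (k - c - b) + s2 * b + s3 * c}"
      by (auto simp: T_def)
    then show ?thesis using fin by (simp add: case_prod_unfold sum_of_bool_eq)
  qed
  also have "\<dots> = (\<Sum>c\<in>{1..<k}. \<Sum>b\<in>{1..<k-c}. of_bool (q dvd s1 * (k - c - b) + s2 * b + s3 * c))"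
    unfolding S_def by (subst sum.Sigma) auto
  finally show ?thesis .
qed

section \<open>Mixed octants\<close>

lemma positive_count_mixed:
  fixes r d w1 w2 w3 k :: int
  assumes r: "r > 0" and d: "d > 0" "r dvd d"
    and solv: "\<And>h. \<exists>y. r dvd (w2 - w1) * y - 2 * h"
  shows "positive_count (r * d) (1 + w1 * d) (1 + w2 * d) (- (1 + w3 * d)) k =
         positive_count (r * d) (1 - w1 * d) (1 - w2 * d) (- (1 - w3 * d)) k"
proof -
  \<comment> \<open>With \<open>a = n - b\<close> and \<open>c\<close> congruent to \<open>n\<close>
    modulo \<open>r\<close>, the weighted sum \<open>w1 * a + w2 * b - w3 * c\<close> becomes
    \<open>u * n + e * b\<close> modulo \<open>r\<close>.\<close>
  define e u where "e = w2 - w1" and "u = w1 - w3"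
  define C :: "int \<Rightarrow> int \<Rightarrow> int" where
    "C n h = (\<Sum>b\<in>{1..<n}. of_bool (r dvd h + u * n + e * b))" for n h
  \<comment> \<open>\<open>n\<close> stands for \<open>k - c = a + b\<close>, which is congruent to \<open>c\<close> modulo \<open>r\<close>\<close>
  define E where "E n h = C n h - C n (- h)" for n h
  \<comment> \<open>Here \<open>a + b - c = k - 2 * c\<close>, so \<open>H c\<close> is the quotient
    called h in the overview.\<close>
  define H where "H c = (k - 2 * c) div d" for c
  have E_step: "E (n + r) h = E n h" if "n \<ge> 1" for n h
  proof -
    have split: "C (n + r) h = C n h + (\<Sum>b\<in>{n..<n+r}. of_bool (r dvd h + u * n + e * b))" for h
    proof -
      have un: "{1..<n+r} = {1..<n} \<union> {n..<n+r}" using that r by auto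
      have cong: "r dvd h + u * (n + r) + e * b \<longleftrightarrow> r dvd h + u * n + e * b" for b
        by (rule dvd_iff_of_dvd_diff) (simp add: algebra_simps)
      show ?thesis
        unfolding C_def cong un by (rule sum.union_disjoint) auto
    qed
    obtain y where y: "r dvd e * y - 2 * h" using solv unfolding e_def by blast
    \<comment> \<open>Over a full period \<open>b\<close> may be replaced by \<open>b - y\<close>,
      which lowers \<open>e * b\<close> by \<open>2 * h\<close> modulo \<open>r\<close> and so turns
      \<open>h\<close> into \<open>- h\<close>. The added period therefore cancels in
      \<open>E\<close>.\<close>
    have "(\<Sum>b\<in>{n..<n+r}. of_bool (r dvd h + u * n + e * b)) =
          (\<Sum>b\<in>{n..<n+r}. of_bool (r dvd h + u * n + e * (b + - y)) :: int)"
    proof (rule sum_int_period_shift[symmetric])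
      show "of_bool (r dvd h + u * n + e * (x + r)) = (of_bool (r dvd h + u * n + e * x) :: int)" for x
        by (intro arg_cong[where f = of_bool] dvd_iff_of_dvd_diff) (simp add: algebra_simps)
    qed (use r in simp)
    also have "\<dots> = (\<Sum>b\<in>{n..<n+r}. of_bool (r dvd - h + u * n + e * b))"
    proof (intro sum.cong refl arg_cong[where f = of_bool] dvd_iff_of_dvd_diff)
      fix b
      have "h + u * n + e * (b + - y) - (- h + u * n + e * b) = - (e * y - 2 * h)"
        by (simp add: algebra_simps)
      then show "r dvd h + u * n + e * (b + - y) - (- h + u * n + e * b)"
        using y by (simp only: dvd_minus_iff)
    qed
    finally show ?thesis unfolding E_def split by simp
  qed
  have E_add: "E (n + int j * r) h = E n h" if "n \<ge> 1" for n h j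
  proof (induction j)
    case (Suc j)
    have "n + int j * r \<ge> 1" using that r by (simp add: add_increasing2)
    from E_step[OF this, of h] Suc show ?case by (simp add: algebra_simps)
  qed simp
  have E_le: "E n h = E m h" if mn: "m \<ge> 1" "m \<le> n" "r dvd n - m" for n m h
  proof -
    obtain j where j: "n - m = r * j" using mn(3) by blast
    with mn r have "j \<ge> 0" by (smt (verit) mult_less_0_iff)
    then show ?thesis using E_add[OF mn(1), of "nat j" h] j by (simp add: algebra_simps)
  qed
  have E_cong: "E n h = E m h" if "n \<ge> 1" "m \<ge> 1" "r dvd n - m" for n m h
    using E_le[of m n h] E_le[of n m h] that by (metis dvd_diff_commute linear)
  \<comment> \<open>The sign \<open>s\<close> selects the lattice. Since \<open>s * s = 1\<close>,
    multiplying the condition modulo \<open>r\<close> by \<open>s\<close> moves the sign from the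
    weights to \<open>H c\<close>.\<close>
  have count: "int (positive_count (r * d) (1 + w1 * (s * d)) (1 + w2 * (s * d)) (- (1 + w3 * (s * d))) k)
      = (\<Sum>c\<in>{1..<k}. if d dvd k - 2 * c then C (k - c) (s * H c) else 0)"
    if s: "s = 1 \<or> s = -1" for s
    unfolding positive_count_eq_sum
  proof (rule sum.cong[OF refl])
    fix c
    define n where "n = k - c"
    have "r * d dvd (1 + w1 * (s * d)) * (k - c - b) + (1 + w2 * (s * d)) * b + - (1 + w3 * (s * d)) * c
        \<longleftrightarrow> d dvd k - 2 * c \<and> r dvd s * H c + u * n + e * b" for b
    proof -
      have eq: "(1 + w1 * (s * d)) * (k - c - b) + (1 + w2 * (s * d)) * b + - (1 + w3 * (s * d)) * c
          = (k - 2 * c) + d * (s * (w1 * (k - c - b) + w2 * b - w3 * c))"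
        by (simp add: algebra_simps)
      have "r dvd H c + s * (w1 * (k - c - b) + w2 * b - w3 * c) \<longleftrightarrow> r dvd s * H c + u * n + e * b"
        if "d dvd k - 2 * c"
      proof -
        \<comment> \<open>This is the error made by replacing \<open>c\<close> with \<open>n\<close>
          in the weighted sum, as \<open>n - c = k - 2 * c\<close>.\<close>
        have k: "r dvd w3 * (k - 2 * c)" using that d by (meson dvd_trans dvd_mult)
        have "r dvd s * (H c + s * (w1 * (k - c - b) + w2 * b - w3 * c))
            \<longleftrightarrow> r dvd s * H c + u * n + e * b"
          by (rule dvd_iff_of_dvd_diff)
            (use s k in \<open>auto simp: e_def u_def n_def algebra_simps\<close>)
        moreover have "r dvd s * z \<longleftrightarrow> r dvd z" for z using s by auto
        ultimately show ?thesis by simp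
      qed
      then show ?thesis unfolding eq using mult_dvd_add_mult_iff d H_def by auto
    qed
    then show "(\<Sum>b\<in>{1..<k-c}. of_bool (r * d dvd (1 + w1 * (s * d)) * (k - c - b)
          + (1 + w2 * (s * d)) * b + - (1 + w3 * (s * d)) * c)) =
        (if d dvd k - 2 * c then C (k - c) (s * H c) else 0)"
      by (simp add: C_def n_def)
  qed
  define D where "D = (\<Sum>c\<in>{1..<k}. if d dvd k - 2 * c then E (k - c) (H c) else 0)"
  \<comment> \<open>The reflection of \<open>c\<close> to \<open>k - c\<close> exchanges
    \<open>n\<close> and \<open>c\<close> and negates \<open>H\<close>. As \<open>E\<close> depends
    on \<open>n\<close> only modulo \<open>r\<close> and is odd in \<open>h\<close>, this gives
    \<open>D = - D\<close>.\<close>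
  have "D = (\<Sum>c\<in>{1..<k}. if d dvd k - 2 * (k - c) then E (k - (k - c)) (H (k - c)) else 0)"
    unfolding D_def by (rule sum.reindex_bij_witness[of _ "\<lambda>c. k - c" "\<lambda>c. k - c"]) auto
  also have "\<dots> = (\<Sum>c\<in>{1..<k}. - (if d dvd k - 2 * c then E (k - c) (H c) else 0))"
  proof (rule sum.cong[OF refl])
    fix c assume c: "c \<in> {1..<k}"
    have eq: "k - 2 * (k - c) = - (k - 2 * c)" by simp
    have "E c (H (k - c)) = - E (k - c) (H c)" if dv: "d dvd k - 2 * c"
    proof -
      have "H (k - c) = - H c" unfolding H_def eq using dv by (simp only: dvd_neg_div)
      moreover have "E c (H c) = E (k - c) (H c)"
        using c dv d by (intro E_cong) (auto simp: dvd_diff_commute intro: dvd_trans)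
      ultimately show ?thesis by (simp add: E_def)
    qed
    then show "(if d dvd k - 2 * (k - c) then E (k - (k - c)) (H (k - c)) else 0) =
        - (if d dvd k - 2 * c then E (k - c) (H c) else 0)"
      unfolding eq dvd_minus_iff by simp
  qed
  also have "\<dots> = - D" by (simp add: D_def sum_negf)
  finally have "D = 0" by simp
  moreover have "D = (\<Sum>c\<in>{1..<k}. if d dvd k - 2 * c then C (k - c) (H c) else 0)
      - (\<Sum>c\<in>{1..<k}. if d dvd k - 2 * c then C (k - c) (- H c) else 0)"
    unfolding D_def E_def by (subst sum_subtractf[symmetric]) (rule sum.cong, auto)
  ultimately have "int (positive_count (r * d) (1 + w1 * (1 * d)) (1 + w2 * (1 * d)) (- (1 + w3 * (1 * d))) k)
      = int (positive_count (r * d) (1 + w1 * (-1 * d)) (1 + w2 * (-1 * d)) (- (1 + w3 * (-1 * d))) k)"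
    unfolding count[OF disjI1[OF refl]] count[OF disjI2[OF refl]] unfolding mult_1 mult_minus1 by simp
  then show ?thesis by simp
qed

section \<open>The positive octant\<close>

lemma positive_count_plus:
  fixes r d k :: int
  assumes r: "r > 0" "coprime 3 r" and d: "d > 0" "r dvd d"
  shows "positive_count (r * d) 1 (1 + d) (1 + 3 * d) k =
         positive_count (r * d) 1 (1 - d) (1 - 3 * d) k"
proof (cases "k \<ge> 1 \<and> d dvd k")
  case False
  \<comment> \<open>All coordinates being positive, \<open>a + b + c\<close> is \<open>k\<close>
    itself: no solution exists unless \<open>k \<ge> 1\<close> and \<open>d dvd k\<close>.\<close>
  have "positive_count (r * d) 1 (1 + s * d) (1 + 3 * (s * d)) k = 0" for s
  proof -
    have "\<not> r * d dvd a + (1 + s * d) * b + (1 + 3 * (s * d)) * c" if "a + b + c = k" "k \<ge> 1" for a b c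
    proof -
      have "a + (1 + s * d) * b + (1 + 3 * (s * d)) * c = k + d * (s * (b + 3 * c))"
        using that by (simp add: algebra_simps)
      then show ?thesis using mult_dvd_add_mult_iff False that d by auto
    qed
    then have *: "{(a, b, c). 0 < a \<and> 0 < b \<and> 0 < c \<and> a + b + c = k \<and>
      r * d dvd 1 * a + (1 + s * d) * b + (1 + 3 * (s * d)) * c} = {}" by force
    show ?thesis unfolding positive_count_def * by simp
  qed
  from this[of 1] this[of "-1"] show ?thesis by simp
next
  case True
  then have k: "k \<ge> 1" "d dvd k" "r dvd k" using d by (auto intro: dvd_trans)
  define P :: "int \<Rightarrow> int" where
    "P h = (\<Sum>c\<in>{1..<k}. \<Sum>b\<in>{1..<k-c}. of_bool (r dvd h + 3 * c + b))" for h
  \<comment> \<open>The quotient \<open>k div d\<close> is the same for every triple, so passing to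
    the other lattice only negates the argument of \<open>P\<close>.\<close>
  have count: "int (positive_count (r * d) 1 (1 + s * d) (1 + 3 * (s * d)) k) = P (s * (k div d))"
    if s: "s = 1 \<or> s = -1" for s
  proof -
    have dvd_s: "r dvd s * z \<longleftrightarrow> r dvd z" for z using s by auto
    have "r * d dvd 1 * (k - c - b) + (1 + s * d) * b + (1 + 3 * (s * d)) * c
        \<longleftrightarrow> r dvd s * (k div d) + 3 * c + b" for b c
    proof -
      have "1 * (k - c - b) + (1 + s * d) * b + (1 + 3 * (s * d)) * c = k + d * (s * (b + 3 * c))"
        by (simp add: algebra_simps)
      moreover have "s * (k div d) + 3 * c + b = s * (k div d + s * (b + 3 * c))"
        using s by auto
      ultimately show ?thesis
        using mult_dvd_add_mult_iff[of d r k] d(1) k(2) by (simp only: dvd_s) simp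
    qed
    then show ?thesis unfolding positive_count_eq_sum P_def by simp
  qed
  \<comment> \<open>The reflection of \<open>b\<close> to \<open>k - b\<close>, with
    \<open>r dvd k\<close>, shows that the term \<open>c = 0\<close> is the same for
    \<open>h\<close> and \<open>- h\<close>.\<close>
  have bij: "(\<Sum>b\<in>{1..<k}. of_bool (r dvd h + b)) = (\<Sum>b\<in>{1..<k}. of_bool (r dvd - h + b) :: int)" for h
  proof (rule sum.reindex_bij_witness[of _ "\<lambda>b. k - b" "\<lambda>b. k - b"])
    fix b
    have "h + b - k = - (- h + (k - b))" by simp
    then show "of_bool (r dvd - h + (k - b)) = (of_bool (r dvd h + b) :: int)"
      using dvd_iff_of_dvd_diff[of r "h + b" "h + b - k"] k by (simp only: dvd_minus_iff) simp
  qed auto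
  \<comment> \<open>the second sum on the left is the term \<open>c = 0\<close>, added to complete the period\<close>
  have P_eq: "r * (P h + (\<Sum>b\<in>{1..<k}. of_bool (r dvd h + b))) =
      (\<Sum>c\<in>{0..<k}. k - c - 1) - (\<Sum>c\<in>{0..<k}. (h + 2 * c + k - 1) mod r)
        + (\<Sum>c\<in>{0..<k}. (h + 3 * c) mod r)" for h
  proof -
    have "{0..<k} = insert 0 {1..<k}" using k by auto
    then have P_sum: "P h + (\<Sum>b\<in>{1..<k}. of_bool (r dvd h + b)) =
        (\<Sum>c\<in>{0..<k}. \<Sum>b\<in>{1..<k-c}. of_bool (r dvd h + 3 * c + b))"
      by (simp add: P_def)
    have "r * (\<Sum>c\<in>{0..<k}. \<Sum>b\<in>{1..<k-c}. of_bool (r dvd h + 3 * c + b))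
        = (\<Sum>c\<in>{0..<k}. (k - c - 1) - (h + 2 * c + k - 1) mod r + (h + 3 * c) mod r)"
    proof (subst sum_distrib_left, rule sum.cong[OF refl])
      fix c assume "c \<in> {0..<k}"
      then have "k - c \<ge> 1" by simp
      \<comment> \<open>The residues at the two ends, \<open>b = 0\<close> and
        \<open>b = k - c - 1\<close>, carry the slopes 3 and 2 in \<open>c\<close>.\<close>
      note sum_of_bool_dvd_eq[OF r(1) this, of "h + 3 * c"]
      also have "h + 3 * c + (k - c) - 1 = h + 2 * c + k - 1" by simp
      finally show "r * (\<Sum>b\<in>{1..<k-c}. of_bool (r dvd h + 3 * c + b))
          = k - c - 1 - (h + 2 * c + k - 1) mod r + (h + 3 * c) mod r" .
    qed
    also have "\<dots> = (\<Sum>c\<in>{0..<k}. k - c - 1) - (\<Sum>c\<in>{0..<k}. (h + 2 * c + k - 1) mod r)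
        + (\<Sum>c\<in>{0..<k}. (h + 3 * c) mod r)"
      by (subst sum.distrib, subst sum_subtractf) (rule refl)
    finally show ?thesis unfolding P_sum .
  qed
  \<comment> \<open>Because \<open>r dvd k\<close>, the range of \<open>c\<close> consists of full
    periods, and shifting \<open>c\<close> by \<open>- y\<close> subtracts \<open>2 * h\<close>
    modulo \<open>r\<close>.\<close>
  have mod_shift: "(\<Sum>c\<in>{0..<k}. (h + e * c + z) mod r) = (\<Sum>c\<in>{0..<k}. (- h + e * c + z) mod r)"
    if y: "r dvd e * y - 2 * h" for e y h z
  proof -
    have "(\<Sum>c\<in>{0..<0+k}. (h + e * c + z) mod r) = (\<Sum>c\<in>{0..<0+k}. (h + e * (c + - y) + z) mod r)"
    proof (rule sum_int_period_shift[symmetric])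
      show "(h + e * (x + k) + z) mod r = (h + e * x + z) mod r" for x
        by (rule mod_eq_of_dvd_diff) (use k in \<open>simp add: algebra_simps\<close>)
    qed (use k in simp)
    also have "\<dots> = (\<Sum>c\<in>{0..<0+k}. (- h + e * c + z) mod r)"
    proof (intro sum.cong refl mod_eq_of_dvd_diff)
      fix c
      have "h + e * (c + - y) + z - (- h + e * c + z) = - (e * y - 2 * h)"
        by (simp add: algebra_simps)
      then show "r dvd h + e * (c + - y) + z - (- h + e * c + z)"
        using y by (simp only: dvd_minus_iff)
    qed
    finally show ?thesis by simp
  qed
  have "P (- h) = P h" for h
  proof -
    obtain j where "[3 * j = 1] (mod r)" using cong_solve_coprime_int r(2) by blast
    then have "r dvd (3 * j - 1) * (2 * h)" by (simp add: cong_iff_dvd_diff)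
    \<comment> \<open>For slope 3 the shift comes from the inverse \<open>j\<close> of 3 modulo
      \<open>r\<close>; for slope 2 it is \<open>h\<close> itself.\<close>
    then have 3: "r dvd 3 * (j * 2 * h) - 2 * h" by (simp add: algebra_simps)
    have 2: "r dvd 2 * h - 2 * h" by simp
    have "r * (P h + (\<Sum>b\<in>{1..<k}. of_bool (r dvd h + b)))
        = r * (P (- h) + (\<Sum>b\<in>{1..<k}. of_bool (r dvd - h + b)))"
      unfolding P_eq using mod_shift[OF 2, of "k - 1"] mod_shift[OF 3, of 0]
      by (simp only: add_diff_eq add_0_right)
    then show ?thesis
      unfolding bij[of h] using r(1) by (simp only: mult_cancel_left add_right_cancel) simp
  qed
  then have "P (1 * (k div d)) = P (-1 * (k div d))" unfolding mult_1 mult_minus1 by metis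
  then have "positive_count (r * d) 1 (1 + 1 * d) (1 + 3 * (1 * d)) k =
      positive_count (r * d) 1 (1 + -1 * d) (1 + 3 * (-1 * d)) k"
    unfolding count[OF disjI1[OF refl], symmetric] count[OF disjI2[OF refl], symmetric] by linarith
  then show ?thesis by simp
qed

section \<open>Coordinates, and vectors without zeros sorted by octant\<close>

lemma vec3_eq_iff: "(v :: 'a ^ 3) = w \<longleftrightarrow> v $ 1 = w $ 1 \<and> v $ 2 = w $ 2 \<and> v $ 3 = w $ 3"
  by (simp add: vec_eq_iff forall_3)

lemma one_norm_3: "one_norm \<mu> = \<bar>\<mu> $ 1\<bar> + \<bar>\<mu> $ 2\<bar> + \<bar>\<mu> $ 3\<bar>"
  by (simp add: one_norm_def sum_3)

lemma num_zeros_3: "num_zeros \<mu> = of_bool (\<mu> $ 1 = 0) + of_bool (\<mu> $ 2 = 0) + of_bool (\<mu> $ 3 = 0)"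
proof -
  have "num_zeros \<mu> = (\<Sum>j\<in>UNIV. of_bool (\<mu> $ j = 0))"
    by (simp add: num_zeros_def)
  then show ?thesis by (simp add: sum_3)
qed

lemma num_zeros_eq_0_iff: "num_zeros \<mu> = 0 \<longleftrightarrow> \<mu> $ 1 \<noteq> 0 \<and> \<mu> $ 2 \<noteq> 0 \<and> \<mu> $ 3 \<noteq> 0"
  by (simp add: num_zeros_3)

lemma mem_congruence_lattice_iff:
  "\<mu> \<in> congruence_lattice q s1 s2 s3 \<longleftrightarrow> int q dvd \<mu> $ 1 * s1 + \<mu> $ 2 * s2 + \<mu> $ 3 * s3"
  by (simp add: congruence_lattice_def cong_0_iff)

text \<open>Vectors are grouped by sign pattern. Multiplying each coordinate by its sign is an
  involution that makes a group positive and passes the signs to the coefficients.\<close>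

lemma lattice_count_0:
  "lattice_count (congruence_lattice q s1 s2 s3) k 0 =
     (\<Sum>(e1,e2,e3)\<in>{-1,1} \<times> {-1,1} \<times> {-1,1}.
        positive_count (int q) (e1 * s1) (e2 * s2) (e3 * s3) (int k))"
proof -
  define S where "S = {\<mu> \<in> congruence_lattice q s1 s2 s3. one_norm \<mu> = int k \<and> num_zeros \<mu> = 0}"
  define T :: "(int \<times> int \<times> int) set" where "T = {-1,1} \<times> {-1,1} \<times> {-1,1}"
  define g :: "int ^ 3 \<Rightarrow> int \<times> int \<times> int" where "g \<mu> = (sgn (\<mu> $ 1), sgn (\<mu> $ 2), sgn (\<mu> $ 3))" for \<mu>
  have finS: "finite S" unfolding S_def by (rule finite_lattice_count_set)
  have sgn: "sgn x \<in> {-1, 1}" if "x \<noteq> 0" for x :: int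
    using that by (simp add: sgn_if)
  have gS: "g ` S \<subseteq> T"
  proof (rule image_subsetI)
    fix \<mu> assume "\<mu> \<in> S"
    then show "g \<mu> \<in> T"
      unfolding g_def T_def by (intro SigmaI sgn) (simp_all add: S_def num_zeros_eq_0_iff)
  qed
  have finT: "finite T" by (simp add: T_def)
  have "card S = (\<Sum>y\<in>T. card {\<mu>\<in>S. g \<mu> = y})"
    using sum.group[OF finS finT gS, of "\<lambda>_. 1::nat"] by simp
  also have "\<dots> = (\<Sum>(e1,e2,e3)\<in>T. positive_count (int q) (e1 * s1) (e2 * s2) (e3 * s3) (int k))"
  proof (rule sum.cong[OF refl])
    fix y assume "y \<in> T"
    then obtain e1 e2 e3 where y: "y = (e1,e2,e3)" "e1 \<in> {-1,1}" "e2 \<in> {-1,1}" "e3 \<in> {-1,1}"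
      by (auto simp: T_def)
    define O' where "O' = {(a, b, c). a > 0 \<and> b > 0 \<and> c > 0 \<and> a + b + c = int k \<and>
        int q dvd e1 * s1 * a + e2 * s2 * b + e3 * s3 * c}"
    have cancel: "e * (e * x) = x" if "e \<in> {-1,1}" for e x :: int using that by auto
    have pos: "sgn (e * x) = e" "\<bar>e * x\<bar> = x" "e * x \<noteq> 0" if "e \<in> {-1,1}" "x > 0" for e x :: int
      using that by auto
    have sgn: "sgn x * x > 0" "sgn x * x = \<bar>x\<bar>" if "x \<noteq> 0" for x :: int
      using that by (auto simp: sgn_if)
    have "bij_betw (\<lambda>(a,b,c). vector [e1 * a, e2 * b, e3 * c] :: int ^ 3) O' {\<mu>\<in>S. g \<mu> = y}"
    proof (rule bij_betw_byWitness[where f' = "\<lambda>\<mu>. (e1 * \<mu> $ 1, e2 * \<mu> $ 2, e3 * \<mu> $ 3)"])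
      show "\<forall>x\<in>O'. (\<lambda>\<mu>. (e1 * \<mu> $ 1, e2 * \<mu> $ 2, e3 * \<mu> $ 3))
          ((\<lambda>(a,b,c). vector [e1 * a, e2 * b, e3 * c] :: int ^ 3) x) = x"
        by (simp add: cancel[OF y(2)] cancel[OF y(3)] cancel[OF y(4)] vector_3 case_prod_beta)
      show "\<forall>\<mu>\<in>{\<mu>\<in>S. g \<mu> = y}. (\<lambda>(a,b,c). vector [e1 * a, e2 * b, e3 * c] :: int ^ 3)
          (e1 * \<mu> $ 1, e2 * \<mu> $ 2, e3 * \<mu> $ 3) = \<mu>"
        by (simp add: cancel[OF y(2)] cancel[OF y(3)] cancel[OF y(4)] vector_3 vec3_eq_iff)
      show "(\<lambda>(a,b,c). vector [e1 * a, e2 * b, e3 * c] :: int ^ 3) ` O' \<subseteq> {\<mu>\<in>S. g \<mu> = y}"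
        by (clarsimp simp: O'_def S_def g_def y(1) vector_3 mem_congruence_lattice_iff one_norm_3
            num_zeros_eq_0_iff pos[OF y(2)] pos[OF y(3)] pos[OF y(4)]) (use y(2-4) in \<open>auto simp: mult_ac\<close>)
      show "(\<lambda>\<mu>. (e1 * \<mu> $ 1, e2 * \<mu> $ 2, e3 * \<mu> $ 3)) ` {\<mu>\<in>S. g \<mu> = y} \<subseteq> O'"
      proof
        fix p assume "p \<in> (\<lambda>\<mu>. (e1 * \<mu> $ 1, e2 * \<mu> $ 2, e3 * \<mu> $ 3)) ` {\<mu>\<in>S. g \<mu> = y}"
        then obtain \<mu> where \<mu>: "\<mu> \<in> S" "g \<mu> = y" "p = (e1 * \<mu> $ 1, e2 * \<mu> $ 2, e3 * \<mu> $ 3)" by blast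
        then have e: "e1 = sgn (\<mu> $ 1)" "e2 = sgn (\<mu> $ 2)" "e3 = sgn (\<mu> $ 3)"
          by (simp_all add: g_def y(1))
        have nz: "\<mu> $ 1 \<noteq> 0" "\<mu> $ 2 \<noteq> 0" "\<mu> $ 3 \<noteq> 0" "one_norm \<mu> = int k"
          and dv: "int q dvd \<mu> $ 1 * s1 + \<mu> $ 2 * s2 + \<mu> $ 3 * s3"
          using \<mu>(1) by (simp_all add: S_def num_zeros_eq_0_iff mem_congruence_lattice_iff)
        have "e1 * s1 * (e1 * \<mu> $ 1) = \<mu> $ 1 * s1" "e2 * s2 * (e2 * \<mu> $ 2) = \<mu> $ 2 * s2"
          "e3 * s3 * (e3 * \<mu> $ 3) = \<mu> $ 3 * s3"
          using cancel[OF y(2), of "\<mu> $ 1 * s1"] cancel[OF y(3), of "\<mu> $ 2 * s2"]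
            cancel[OF y(4), of "\<mu> $ 3 * s3"] by (simp_all only: mult_ac)
        moreover have "e1 * \<mu> $ 1 > 0" "e2 * \<mu> $ 2 > 0" "e3 * \<mu> $ 3 > 0"
          using nz sgn(1) by (simp_all only: e not_False_eq_True)
        moreover have "e1 * \<mu> $ 1 + e2 * \<mu> $ 2 + e3 * \<mu> $ 3 = int k"
          using nz by (simp only: e sgn(2) one_norm_3 not_False_eq_True)
        ultimately show "p \<in> O'" using dv
          unfolding \<mu>(3) O'_def by (simp only: mem_Collect_eq case_prod_conv simp_thms)
      qed
    qed
    from bij_betw_same_card[OF this]
    show "card {\<mu>\<in>S. g \<mu> = y} = (case y of (e1,e2,e3) \<Rightarrow>
        positive_count (int q) (e1 * s1) (e2 * s2) (e3 * s3) (int k))"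
      by (simp add: y positive_count_def O'_def)
  qed
  finally show ?thesis by (simp add: lattice_count_def S_def T_def)
qed

section \<open>Vectors with at least one zero\<close>

lemma dvd_swap_iff:
  fixes r d w1 w2 x y :: int
  assumes "r dvd d"
  shows "r * d dvd x * (1 + w1 * d) + y * (1 + w2 * d) \<longleftrightarrow> r * d dvd y * (1 - w1 * d) + x * (1 - w2 * d)"
    (is "?A \<longleftrightarrow> ?B")
proof -
  \<comment> \<open>Either divisibility forces \<open>d dvd x + y\<close>, hence
    \<open>r dvd x + y\<close>, and then this difference is a multiple of
    \<open>r * d\<close>.\<close>
  have diff: "x * (1 + w1 * d) + y * (1 + w2 * d) - (y * (1 - w1 * d) + x * (1 - w2 * d))
      = (w1 + w2) * ((x + y) * d)"
    by (simp add: algebra_simps)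
  have iff: "?A \<longleftrightarrow> ?B" if "d dvd x + y"
  proof (rule dvd_iff_of_dvd_diff)
    have "r * d dvd (x + y) * d"
      using dvd_trans[OF assms that] by (rule mult_dvd_mono) simp
    then show "r * d dvd x * (1 + w1 * d) + y * (1 + w2 * d) - (y * (1 - w1 * d) + x * (1 - w2 * d))"
      unfolding diff by (rule dvd_mult)
  qed
  have "d dvd x + y" if ?A
  proof -
    from that have "d dvd x * (1 + w1 * d) + y * (1 + w2 * d)" by (rule dvd_mult_right)
    moreover have "x * (1 + w1 * d) + y * (1 + w2 * d) = (x + y) + (x * w1 + y * w2) * d"
      by (simp add: algebra_simps)
    ultimately show ?thesis by (simp only: dvd_add_times_triv_right_iff)
  qed
  moreover have "d dvd x + y" if ?B
  proof -
    from that have "d dvd y * (1 - w1 * d) + x * (1 - w2 * d)" by (rule dvd_mult_right)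
    moreover have "y * (1 - w1 * d) + x * (1 - w2 * d) = (x + y) + (- (y * w1 + x * w2)) * d"
      by (simp add: algebra_simps)
    ultimately show ?thesis by (simp only: dvd_add_times_triv_right_iff)
  qed
  ultimately show ?thesis using iff by blast
qed

text \<open>Being the identity on all vectors that do not have exactly one zero makes this an
  involution of the whole space, so one map serves every \<open>l \<noteq> 0\<close>.\<close>

definition swap_nonzeros :: "int ^ 3 \<Rightarrow> int ^ 3" where
  "swap_nonzeros \<mu> =
     (if num_zeros \<mu> \<noteq> 1 then \<mu>
      else if \<mu> $ 3 = 0 then vector [\<mu> $ 2, \<mu> $ 1, 0]
      else if \<mu> $ 2 = 0 then vector [\<mu> $ 3, 0, \<mu> $ 1]
      else vector [0, \<mu> $ 3, \<mu> $ 2])"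

lemma num_zeros_vector_3:
  "num_zeros (vector [a, b, c]) = of_bool (a = 0) + of_bool (b = 0) + of_bool (c = 0)"
  by (simp add: num_zeros_3 vector_3)

lemma swap_nonzeros_id: "num_zeros \<mu> \<noteq> 1 \<Longrightarrow> swap_nonzeros \<mu> = \<mu>"
  by (simp add: swap_nonzeros_def)

lemma swap_nonzeros_vector:
  assumes "a \<noteq> 0" "b \<noteq> 0"
  shows "swap_nonzeros (vector [a, b, 0]) = vector [b, a, 0]"
    "swap_nonzeros (vector [a, 0, b]) = vector [b, 0, a]"
    "swap_nonzeros (vector [0, a, b]) = vector [0, b, a]"
  using assms by (simp_all add: swap_nonzeros_def num_zeros_vector_3 vector_3)

lemma num_zeros_1_cases:
  assumes "num_zeros \<mu> = 1"
  obtains a b where "a \<noteq> 0" "b \<noteq> 0"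
    "\<mu> = vector [a, b, 0] \<or> \<mu> = vector [a, 0, b] \<or> \<mu> = vector [0, a, b]"
proof -
  have vec: "\<mu> = vector [\<mu> $ 1, \<mu> $ 2, \<mu> $ 3]"
    by (simp add: vec3_eq_iff vector_3)
  consider "\<mu> $ 1 = 0" "\<mu> $ 2 \<noteq> 0" "\<mu> $ 3 \<noteq> 0" | "\<mu> $ 1 \<noteq> 0" "\<mu> $ 2 = 0" "\<mu> $ 3 \<noteq> 0"
    | "\<mu> $ 1 \<noteq> 0" "\<mu> $ 2 \<noteq> 0" "\<mu> $ 3 = 0"
    using assms unfolding num_zeros_3
    by (cases "\<mu> $ 1 = 0"; cases "\<mu> $ 2 = 0"; cases "\<mu> $ 3 = 0") simp_all
  then show thesis
    by cases (metis that vec)+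
qed

lemma swap_nonzeros_invariants:
  "num_zeros (swap_nonzeros \<mu>) = num_zeros \<mu>"
  "one_norm (swap_nonzeros \<mu>) = one_norm \<mu>"
  "swap_nonzeros (swap_nonzeros \<mu>) = \<mu>"
  by (cases "num_zeros \<mu> = 1"; (elim num_zeros_1_cases disjE)?;
      simp add: swap_nonzeros_id swap_nonzeros_vector num_zeros_vector_3 one_norm_3 vector_3)+

lemma swap_nonzeros_mem_iff:
  fixes r d :: nat
  assumes "r dvd d" "num_zeros \<mu> \<noteq> 0"
  shows "swap_nonzeros \<mu> \<in> congruence_lattice (r * d) 1 (1 - int d) (1 - 3 * int d)
    \<longleftrightarrow> \<mu> \<in> congruence_lattice (r * d) 1 (1 + int d) (1 + 3 * int d)"
proof -
  have "int r dvd int d" using assms by simp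
  note swap = dvd_swap_iff[OF this]
  show ?thesis
  proof (cases "num_zeros \<mu> = 1")
    case True
    then show ?thesis
    proof (rule num_zeros_1_cases)
      fix a b :: int
      assume "a \<noteq> 0" "b \<noteq> 0"
        "\<mu> = vector [a, b, 0] \<or> \<mu> = vector [a, 0, b] \<or> \<mu> = vector [0, a, b]"
      then show ?thesis
        \<comment> \<open>The coordinates have weights 0, 1, 3; each instance uses the two weights
          left when one coordinate vanishes.\<close>
        using swap[of a 0 b 1] swap[of a 0 b 3] swap[of a 1 b 3]
        by (elim disjE) (simp_all add: swap_nonzeros_vector mem_congruence_lattice_iff vector_3)
    qed
  next
    case False
    have "\<mu> $ 1 = 0 \<and> \<mu> $ 2 = 0 \<or> \<mu> $ 1 = 0 \<and> \<mu> $ 3 = 0 \<or> \<mu> $ 2 = 0 \<and> \<mu> $ 3 = 0"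
      using False assms(2) unfolding num_zeros_3
      by (cases "\<mu> $ 1 = 0"; cases "\<mu> $ 2 = 0"; cases "\<mu> $ 3 = 0") simp_all
    then show ?thesis
      \<comment> \<open>Equal weights and \<open>y = 0\<close> compare
        \<open>x * (1 + w * d)\<close> with \<open>x * (1 - w * d)\<close> for a lone
        coordinate.\<close>
      using swap[of "\<mu> $ 1" 0 0 0] swap[of "\<mu> $ 2" 1 0 1] swap[of "\<mu> $ 3" 3 0 3]
      unfolding swap_nonzeros_id[OF False] mem_congruence_lattice_iff
      by (elim disjE conjE) simp_all
  qed
qed

section \<open>Combining the octants and the vectors with zeros\<close>

theorem theorem6p3:
  fixes r t :: nat
  assumes "r > 0" and "t > 0" and "\<not> [r = 0] (mod 3)"
  shows "one_norm_star_isospectral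
    (congruence_lattice (r\<^sup>2 * t) 1 (1 + int r * int t) (1 + 3 * int r * int t))
    (congruence_lattice (r\<^sup>2 * t) 1 (1 - int r * int t) (1 - 3 * int r * int t))"
proof -
  define d where "d = r * t"
  define L where "L = congruence_lattice (r * d) 1 (1 + int d) (1 + 3 * int d)"
  define L' where "L' = congruence_lattice (r * d) 1 (1 - int d) (1 - 3 * int d)"
  have rd: "r dvd d" by (simp add: d_def)
  have pos: "int r > 0" "int d > 0" "int r dvd int d" using assms rd by (auto simp: d_def)
  have "prime (3 :: nat)" by simp
  then have "coprime 3 r"
    using assms(3) by (simp add: cong_0_iff prime_imp_coprime)
  then have cop: "coprime 3 (int r)"
    using coprime_int_iff[of 3 r] by simp
  \<comment> \<open>These are the differences of the weights 0, 1, 3. Up to sign, 1 and 2 divide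
    \<open>2 * h\<close>, and 3 is invertible modulo \<open>r\<close>.\<close>
  have solv: "\<exists>y. int r dvd e * y - 2 * h" if e: "e \<in> {1, 2, 3, -1, -2, -3}" for e h
  proof -
    obtain j where "[3 * j = 1] (mod int r)" using cong_solve_coprime_int cop by blast
    then have "int r dvd (3 * j - 1) * (2 * h)" by (simp add: cong_iff_dvd_diff)
    then have 3: "int r dvd 3 * (j * 2 * h) - 2 * h" by (simp add: algebra_simps)
    consider "e = 1" | "e = 2" | "e = 3" | "e = -1" | "e = -2" | "e = -3" using e by blast
    then show ?thesis
    proof cases
      case 1 then show ?thesis by (intro exI[of _ "2 * h"]) simp
    next
      case 2 then show ?thesis by (intro exI[of _ h]) simp
    next
      case 3 then show ?thesis using \<open>int r dvd 3 * (j * 2 * h) - 2 * h\<close> by blast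
    next
      case 4 then show ?thesis by (intro exI[of _ "- 2 * h"]) simp
    next
      case 5 then show ?thesis by (intro exI[of _ "- h"]) simp
    next
      case 6 then show ?thesis using 3 by (intro exI[of _ "- (j * 2 * h)"]) simp
    qed
  qed
  have "lattice_count L k 0 = lattice_count L' k 0" for k
  proof -
    define N where "N s1 s2 s3 = positive_count (int (r * d)) s1 s2 s3 (int k)" for s1 s2 s3
    \<comment> \<open>\<open>w = 1\<close> gives \<open>L\<close> and \<open>w = - 1\<close> gives
      \<open>L'\<close>; the \<open>e1\<close>, \<open>e2\<close>, \<open>e3\<close> are the signs
      of the octant.\<close>
    define F where "F w e1 e2 e3 = N (e1 * 1) (e2 * (1 + w * int d)) (e3 * (1 + 3 * (w * int d)))"
      for w e1 e2 e3 :: int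
    have swap: "N b a c = N a b c" "N a c b = N a b c" for a b c
      unfolding N_def by (rule positive_count_swap12, rule positive_count_swap23)
    \<comment> \<open>Opposite octants have equal counts, so four of the eight sign patterns
      suffice.\<close>
    have F_minus: "F w (- e1) (- e2) (- e3) = F w e1 e2 e3" for w e1 e2 e3
      unfolding F_def N_def mult_minus_left by (rule positive_count_minus)
    have mixed: "N (1 + w1 * int d) (1 + w2 * int d) (- (1 + w3 * int d)) =
        N (1 - w1 * int d) (1 - w2 * int d) (- (1 - w3 * int d))"
      if "w2 - w1 \<in> {1, 2, 3, -1, -2, -3}" for w1 w2 w3
      using positive_count_mixed[OF pos solv[OF that], of w3 "int k"] by (simp add: N_def)
    have F_ppp: "F 1 1 1 1 = F (- 1) 1 1 1"
      using positive_count_plus[OF pos(1) cop pos(2,3)] by (simp add: F_def N_def)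
    \<comment> \<open>The instances of \<open>mixed\<close> list \<open>w2\<close>,
      \<open>w1\<close>, \<open>w3\<close>. The last is the weight of the negative coordinate, which
      permuting coefficients brings to third place.\<close>
    have F_ppm: "F 1 1 1 (- 1) = F (- 1) 1 1 (- 1)"
      using mixed[of 1 0 3] by (simp add: F_def)
    have F_pmp: "F 1 1 (- 1) 1 = F (- 1) 1 (- 1) 1"
      using mixed[of 3 0 1] swap(2) by (simp add: F_def)
    have F_mpp: "F 1 (- 1) 1 1 = F (- 1) (- 1) 1 1"
    proof -
      have "N a b c = N c b a" for a b c by (metis swap)
      from this[of "-1" "1 + int d" "1 + 3 * int d"] this[of "-1" "1 - int d" "1 - 3 * int d"]
      show ?thesis using mixed[of 1 3 0] by (simp add: F_def)
    qed
    have F_eq: "F 1 e1 e2 e3 = F (- 1) e1 e2 e3"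
      if "e1 \<in> {-1,1}" "e2 \<in> {-1,1}" "e3 \<in> {-1,1}" for e1 e2 e3
      using that F_ppp F_ppm F_pmp F_mpp F_minus[of _ 1 1 1] F_minus[of _ 1 1 "-1"]
        F_minus[of _ 1 "-1" 1] F_minus[of _ "-1" 1 1]
      by (elim insertE emptyE) (simp_all only: minus_minus)
    have "lattice_count L k 0 = (\<Sum>(e1,e2,e3)\<in>{-1,1} \<times> {-1,1} \<times> {-1,1}. F 1 e1 e2 e3)"
      unfolding L_def lattice_count_0 F_def N_def mult_1 ..
    also have "\<dots> = (\<Sum>(e1,e2,e3)\<in>{-1,1} \<times> {-1,1} \<times> {-1,1}. F (- 1) e1 e2 e3)"
    proof (rule sum.cong[OF refl], clarify)
      fix e1 e2 e3 :: int
      assume "e1 \<in> {-1,1}" "e2 \<in> {-1,1}" "e3 \<in> {-1,1}"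
      then show "F 1 e1 e2 e3 = F (- 1) e1 e2 e3" by (rule F_eq)
    qed
    also have "\<dots> = lattice_count L' k 0"
      unfolding L'_def lattice_count_0 F_def N_def by simp
    finally show ?thesis .
  qed
  moreover have "lattice_count L k l = lattice_count L' k l" if "l \<noteq> 0" for k l
    unfolding lattice_count_def
  proof (rule bij_betw_same_card[OF bij_betw_byWitness[where f = swap_nonzeros and f' = swap_nonzeros]])
    have mem: "swap_nonzeros \<mu> \<in> L' \<longleftrightarrow> \<mu> \<in> L" if "num_zeros \<mu> \<noteq> 0" for \<mu>
      unfolding L_def L'_def using rd that by (rule swap_nonzeros_mem_iff)
    show "swap_nonzeros ` {\<mu> \<in> L. one_norm \<mu> = int k \<and> num_zeros \<mu> = l}
        \<subseteq> {\<mu> \<in> L'. one_norm \<mu> = int k \<and> num_zeros \<mu> = l}"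
      using mem that by (auto simp: swap_nonzeros_invariants)
    show "swap_nonzeros ` {\<mu> \<in> L'. one_norm \<mu> = int k \<and> num_zeros \<mu> = l}
        \<subseteq> {\<mu> \<in> L. one_norm \<mu> = int k \<and> num_zeros \<mu> = l}"
      using mem[of "swap_nonzeros _"] that by (auto simp: swap_nonzeros_invariants)
  qed (simp_all add: swap_nonzeros_invariants)
  ultimately have "lattice_count L k l = lattice_count L' k l" for k l
    by (cases "l = 0") auto
  moreover have "L = congruence_lattice (r\<^sup>2 * t) 1 (1 + int r * int t) (1 + 3 * int r * int t)"
    "L' = congruence_lattice (r\<^sup>2 * t) 1 (1 - int r * int t) (1 - 3 * int r * int t)"
    by (simp_all add: L_def L'_def d_def power2_eq_square mult.assoc)
  ultimately show ?thesis by (simp add: one_norm_star_isospectral_def)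
qed

end
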